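(* Let $n \ge 1$, let $M_n$ be the algebra of $n\times n$ complex matrices, and let $T : M_n \to M_n$ be the triangular transform, which sends $A=(a_{ij})$ to $T(A) = (\mathrm{sgn}(i-j)\, a_{ij})$. Let $\mathcal{S} = (S_t)_{t\ge 0}$ be the semigroup on $M_n$ given by $S_t : (a_{ij}) \mapsto (e^{-t|i-j|} a_{ij})$, and for $A \in M_n$ set $$\|A\|_{\mathrm{BMO}_c(\mathcal{S})} = \sup_{0<t<\infty} \Big\| S_t\big(|A|^2\big) - |S_t A|^2 \Big\|_\infty^{\frac12}.$$ Then for every $A \in M_n$, $$\|T(A)\|_{\mathrm{BMO}_c(\mathcal{S})} = \|A\|_{\mathrm{BMO}_c(\mathcal{S})}.$$
   Context: For a matrix $B \in M_n$, $|B|^2 = B^*B$, where $B^*$ is the conjugate transpose of $B$, and $\|B\|_\infty$ denotes the operator (spectral) norm of $B$ acting on the $n$-dimensional Hilbert space $\ell_2(n)$. Here $\mathrm{sgn}$ is the usual sign function: $\mathrm{sgn}(k)=1$ for $k>0$, $\mathrm{sgn}(k)=-1$ for $k<0$, and $\mathrm{sgn}(0)=0$. *)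

theory Defs
  imports "Jordan_Normal_Form.Schur_Decomposition" "HOL-Analysis.L2_Norm"
begin

definition l2_norm_vec :: "complex vec \<Rightarrow> real" where
  "l2_norm_vec v = L2_set (\<lambda>i. cmod (v $ i)) {..<dim_vec v}"

definition op_norm_mat :: "complex mat \<Rightarrow> real" where
  "op_norm_mat B =
     (SUP v \<in> {v \<in> carrier_vec (dim_col B). l2_norm_vec v \<le> 1}. l2_norm_vec (B *\<^sub>v v))"

definition abs_sq_mat :: "complex mat \<Rightarrow> complex mat" where
  "abs_sq_mat B = mat_adjoint B * B"

(* Matrix indices start at 0; only differences of indices occur below, so this agrees
   with indexing by 1, ..., n. *)

definition triangular_transform :: "complex mat \<Rightarrow> complex mat" where
  "triangular_transform A =
     mat (dim_row A) (dim_col A) (\<lambda>(i, j). of_int (sgn (int i - int j)) * A $$ (i, j))"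

definition exp_semigroup :: "real \<Rightarrow> complex mat \<Rightarrow> complex mat" where
  "exp_semigroup t A =
     mat (dim_row A) (dim_col A)
       (\<lambda>(i, j). of_real (exp (- t * \<bar>real i - real j\<bar>)) * A $$ (i, j))"

definition bmo_c_norm :: "(real \<Rightarrow> complex mat \<Rightarrow> complex mat) \<Rightarrow> complex mat \<Rightarrow> real" where
  "bmo_c_norm S A =
     (SUP t \<in> {0<..}. sqrt (op_norm_mat (S t (abs_sq_mat A) - abs_sq_mat (S t A))))"

(* The suprema above are taken in the conditionally complete lattice of the reals.
   They are genuine (finite) suprema by the lemmas op_norm_mat_bdd_above and
   bmo_c_norm_bdd_above. *)

lemma l2_norm_vec_le_1_nth:
  assumes "l2_norm_vec v \<le> 1" "j < dim_vec v"
  shows "cmod (v $ j) \<le> 1"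
proof -
  have "cmod (v $ j) \<le> L2_set (\<lambda>i. cmod (v $ i)) {..<dim_vec v}"
    using assms(2) by (intro member_le_L2_set) auto
  with assms(1) show ?thesis by (simp add: l2_norm_vec_def)
qed

lemma l2_norm_mult_mat_vec_le:
  assumes v: "v \<in> carrier_vec (dim_col B)" "l2_norm_vec v \<le> 1"
  shows "l2_norm_vec (B *\<^sub>v v) \<le> (\<Sum>i<dim_row B. \<Sum>j<dim_col B. cmod (B $$ (i, j)))"
proof -
  have entry: "cmod ((B *\<^sub>v v) $ i) \<le> (\<Sum>j<dim_col B. cmod (B $$ (i, j)))"
    if i: "i < dim_row B" for i
  proof -
    have "(B *\<^sub>v v) $ i = (\<Sum>j<dim_col B. B $$ (i, j) * v $ j)"
      using i v(1) by (auto simp: scalar_prod_def atLeast0LessThan intro!: sum.cong)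
    also have "cmod \<dots> \<le> (\<Sum>j<dim_col B. cmod (B $$ (i, j) * v $ j))"
      by (rule norm_sum)
    also have "\<dots> \<le> (\<Sum>j<dim_col B. cmod (B $$ (i, j)))"
      using v l2_norm_vec_le_1_nth[OF v(2)]
      by (intro sum_mono) (auto simp: norm_mult intro!: mult_left_le)
    finally show ?thesis .
  qed
  have "l2_norm_vec (B *\<^sub>v v) \<le> (\<Sum>i<dim_row B. cmod ((B *\<^sub>v v) $ i))"
    unfolding l2_norm_vec_def dim_mult_mat_vec by (rule L2_set_le_sum) simp
  also have "\<dots> \<le> (\<Sum>i<dim_row B. \<Sum>j<dim_col B. cmod (B $$ (i, j)))"
    by (intro sum_mono) (use entry in auto)
  finally show ?thesis .
qed

lemma op_norm_mat_bdd_above: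
  "bdd_above ((\<lambda>v. l2_norm_vec (B *\<^sub>v v)) ` {v \<in> carrier_vec (dim_col B). l2_norm_vec v \<le> 1})"
  by (rule bdd_aboveI2) (use l2_norm_mult_mat_vec_le in auto)

lemma op_norm_mat_le:
  "op_norm_mat B \<le> (\<Sum>i<dim_row B. \<Sum>j<dim_col B. cmod (B $$ (i, j)))"
proof -
  have "0\<^sub>v (dim_col B) \<in> {v \<in> carrier_vec (dim_col B). l2_norm_vec v \<le> 1}"
    by (simp add: l2_norm_vec_def L2_set_def)
  thus ?thesis unfolding op_norm_mat_def
    by (intro cSUP_least) (use l2_norm_mult_mat_vec_le in blast)+
qed

lemma abs_sq_mat_carrier:
  "A \<in> carrier_mat m n \<Longrightarrow> abs_sq_mat A \<in> carrier_mat n n"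
  by (auto simp: abs_sq_mat_def mat_adjoint_def)

lemma abs_sq_mat_nth:
  assumes A: "A \<in> carrier_mat m n" and "i < n" "j < n"
  shows "abs_sq_mat A $$ (i, j) = (\<Sum>k<m. cnj (A $$ (k, i)) * A $$ (k, j))"
  using assms
  by (auto simp: abs_sq_mat_def mat_adjoint_def scalar_prod_def mat_of_rows_def
      atLeast0LessThan intro!: sum.cong)

lemma bmo_c_norm_bdd_above:
  fixes A :: "complex mat"
  shows "bdd_above ((\<lambda>t. sqrt (op_norm_mat
    (exp_semigroup t (abs_sq_mat A) - abs_sq_mat (exp_semigroup t A)))) ` {0<..})"
proof -
  define m n where "m = dim_row A" and "n = dim_col A"
  have A: "A \<in> carrier_mat m n" by (simp add: m_def n_def)
  define C where "C = (\<Sum>i<n. \<Sum>j<n. cmod (abs_sq_mat A $$ (i, j)) +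
    (\<Sum>k<m. cmod (A $$ (k, i)) * cmod (A $$ (k, j))))"
  have "op_norm_mat (exp_semigroup t (abs_sq_mat A) - abs_sq_mat (exp_semigroup t A)) \<le> C"
    if t: "t > 0" for t
  proof -
    let ?S = "exp_semigroup t" and ?e = "\<lambda>i j. exp (- t * \<bar>real i - real j\<bar>)"
    have e: "?e i j \<le> 1" for i j using t by simp
    have SA: "?S A \<in> carrier_mat m n" using A by (auto simp: exp_semigroup_def)
    have nthS: "?S A $$ (k, i) = of_real (?e k i) * A $$ (k, i)" if "k < m" "i < n" for k i
      using A that by (auto simp: exp_semigroup_def)
    have dims: "dim_row (abs_sq_mat A) = n" "dim_col (abs_sq_mat A) = n"
      "dim_row (abs_sq_mat (?S A)) = n" "dim_col (abs_sq_mat (?S A)) = n"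
      using abs_sq_mat_carrier[OF A] abs_sq_mat_carrier[OF SA] by auto
    have entry: "cmod ((?S (abs_sq_mat A) - abs_sq_mat (?S A)) $$ (i, j))
      \<le> cmod (abs_sq_mat A $$ (i, j)) + (\<Sum>k<m. cmod (A $$ (k, i)) * cmod (A $$ (k, j)))"
      if ij: "i < n" "j < n" for i j
    proof -
      have "cmod ((?S (abs_sq_mat A) - abs_sq_mat (?S A)) $$ (i, j))
        \<le> cmod (of_real (?e i j) * abs_sq_mat A $$ (i, j)) + cmod (abs_sq_mat (?S A) $$ (i, j))"
        using ij dims by (auto simp: exp_semigroup_def intro!: norm_triangle_ineq4)
      also have "cmod (of_real (?e i j) * abs_sq_mat A $$ (i, j)) \<le> cmod (abs_sq_mat A $$ (i, j))"
        using e[of i j] by (simp add: norm_mult mult_left_le_one_le)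
      also have "cmod (abs_sq_mat (?S A) $$ (i, j))
        \<le> (\<Sum>k<m. cmod (cnj (?S A $$ (k, i)) * ?S A $$ (k, j)))"
        unfolding abs_sq_mat_nth[OF SA ij] by (rule norm_sum)
      also have "\<dots> \<le> (\<Sum>k<m. cmod (A $$ (k, i)) * cmod (A $$ (k, j)))"
      proof (rule sum_mono)
        fix k assume "k \<in> {..<m}"
        hence k: "k < m" by simp
        show "cmod (cnj (?S A $$ (k, i)) * ?S A $$ (k, j)) \<le> cmod (A $$ (k, i)) * cmod (A $$ (k, j))"
          unfolding nthS[OF k ij(1)] nthS[OF k ij(2)] norm_mult complex_mod_cnj norm_of_real
          using e by (intro mult_mono) (auto intro!: mult_left_le_one_le simp del: exp_le_one_iff)
      qed
      finally show ?thesis by simp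
    qed
    have "op_norm_mat (?S (abs_sq_mat A) - abs_sq_mat (?S A))
      \<le> (\<Sum>i<n. \<Sum>j<n. cmod ((?S (abs_sq_mat A) - abs_sq_mat (?S A)) $$ (i, j)))"
      using op_norm_mat_le[of "?S (abs_sq_mat A) - abs_sq_mat (?S A)"] dims by simp
    also have "\<dots> \<le> C" unfolding C_def by (intro sum_mono entry) auto
    finally show ?thesis .
  qed
  thus ?thesis by (intro bdd_aboveI2[where M = "sqrt C"]) auto
qed

end

theory Submission
  imports Defs
begin

text \<open>
  The triangular transform leaves the matrix \<open>S\<^sub>t(|A|\<^sup>2) - |S\<^sub>t A|\<^sup>2\<close> itself unchanged, for each
  \<open>t\<close> separately; equality of the two norms is then immediate. Its \<open>(i, j)\<close> entry is the sum over
  \<open>k\<close> of \<open>cnj (a\<^sub>k\<^sub>i) a\<^sub>k\<^sub>j\<close> with weight \<open>exp (- t |i - j|) - exp (- t (|k - i| + |k - j|))\<close>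
  (\<open>carre_du_champ_nth\<close>). Replacing \<open>A\<close> by \<open>T(A)\<close> multiplies the \<open>k\<close>-th summand by
  \<open>sgn (k - i) sgn (k - j)\<close>. If \<open>k\<close> lies strictly on one side of both \<open>i\<close> and \<open>j\<close>, this factor is
  1. Otherwise \<open>k\<close> lies between \<open>i\<close> and \<open>j\<close>, endpoints included; then
  \<open>|i - j| = |k - i| + |k - j|\<close> and the weight vanishes, so the factor has no effect
  (\<open>sgn_mult_weight\<close>).
\<close>

lemma exp_semigroup_carrier:
  "A \<in> carrier_mat m n \<Longrightarrow> exp_semigroup t A \<in> carrier_mat m n"
  by (auto simp: exp_semigroup_def)

lemma exp_semigroup_nth:
  "\<lbrakk>A \<in> carrier_mat m n; i < m; j < n\<rbrakk> \<Longrightarrow>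
    exp_semigroup t A $$ (i, j) = of_real (exp (- t * \<bar>real i - real j\<bar>)) * A $$ (i, j)"
  by (auto simp: exp_semigroup_def)

lemma triangular_transform_carrier:
  "A \<in> carrier_mat m n \<Longrightarrow> triangular_transform A \<in> carrier_mat m n"
  by (auto simp: triangular_transform_def)

lemma triangular_transform_nth:
  "\<lbrakk>A \<in> carrier_mat m n; i < m; j < n\<rbrakk> \<Longrightarrow>
    triangular_transform A $$ (i, j) = of_int (sgn (int i - int j)) * A $$ (i, j)"
  by (auto simp: triangular_transform_def)

text \<open>
  This is the integrated form of the carre du champ of the semigroup, whose norms define the
  \<open>BMO\<close> norm.
\<close>
definition carre_du_champ :: "real \<Rightarrow> complex mat \<Rightarrow> complex mat" where
  "carre_du_champ t A = exp_semigroup t (abs_sq_mat A) - abs_sq_mat (exp_semigroup t A)"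

lemma carre_du_champ_carrier:
  "A \<in> carrier_mat m n \<Longrightarrow> carre_du_champ t A \<in> carrier_mat n n"
  unfolding carre_du_champ_def
  by (intro minus_carrier_mat abs_sq_mat_carrier exp_semigroup_carrier)

definition weight :: "real \<Rightarrow> nat \<Rightarrow> nat \<Rightarrow> nat \<Rightarrow> real" where
  "weight t k i j =
     exp (- t * \<bar>real i - real j\<bar>) - exp (- t * (\<bar>real k - real i\<bar> + \<bar>real k - real j\<bar>))"

lemma carre_du_champ_nth:
  assumes A: "A \<in> carrier_mat m n" and ij: "i < n" "j < n"
  shows "carre_du_champ t A $$ (i, j) =
    (\<Sum>k<m. of_real (weight t k i j) * (cnj (A $$ (k, i)) * A $$ (k, j)))"
proof -
  note SA = exp_semigroup_carrier[OF A, of t]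
  have "carre_du_champ t A $$ (i, j) =
      exp_semigroup t (abs_sq_mat A) $$ (i, j) - abs_sq_mat (exp_semigroup t A) $$ (i, j)"
    unfolding carre_du_champ_def using abs_sq_mat_carrier[OF SA] ij by simp
  also have "exp_semigroup t (abs_sq_mat A) $$ (i, j) =
      (\<Sum>k<m. of_real (exp (- t * \<bar>real i - real j\<bar>)) * (cnj (A $$ (k, i)) * A $$ (k, j)))"
    unfolding exp_semigroup_nth[OF abs_sq_mat_carrier[OF A] ij] abs_sq_mat_nth[OF A ij]
    by (rule sum_distrib_left)
  also have "abs_sq_mat (exp_semigroup t A) $$ (i, j) =
      (\<Sum>k<m. of_real (exp (- t * (\<bar>real k - real i\<bar> + \<bar>real k - real j\<bar>))) *
        (cnj (A $$ (k, i)) * A $$ (k, j)))"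
    unfolding abs_sq_mat_nth[OF SA ij] distrib_left exp_add
    by (intro sum.cong) (auto simp: exp_semigroup_nth[OF A] ij exp_of_real)
  finally show ?thesis
    by (simp add: weight_def sum_subtractf [symmetric] left_diff_distrib)
qed

text \<open>
  The sign product differs from 1 exactly for \<open>k\<close> in the closed interval spanned by \<open>i\<close> and \<open>j\<close>,
  and there the triangle inequality for \<open>|i - j|\<close> is an equality.
\<close>
lemma sgn_mult_weight:
  "of_int (sgn (int k - int i) * sgn (int k - int j)) * weight t k i j = weight t k i j"
proof (cases "(k < i \<and> k < j) \<or> (i < k \<and> j < k)")
  case True
  then have "sgn (int k - int i) * sgn (int k - int j) = 1"
    by (auto simp: sgn_if)
  then show ?thesis by simp
next
  case False
  then have "\<bar>real k - real i\<bar> + \<bar>real k - real j\<bar> = \<bar>real i - real j\<bar>"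
    by auto
  then have "weight t k i j = 0"
    by (simp add: weight_def)
  then show ?thesis by simp
qed

lemma carre_du_champ_triangular_transform:
  "carre_du_champ t (triangular_transform A) = carre_du_champ t A"
proof -
  define m n where "m = dim_row A" and "n = dim_col A"
  have A: "A \<in> carrier_mat m n" by (simp add: m_def n_def)
  note TA = triangular_transform_carrier[OF A]
  show ?thesis
  proof (rule eq_matI)
    fix i j assume "i < dim_row (carre_du_champ t A)" "j < dim_col (carre_du_champ t A)"
    then have ij: "i < n" "j < n" using carre_du_champ_carrier[OF A, of t] by auto
    have "of_real (weight t k i j) *
          (cnj (triangular_transform A $$ (k, i)) * triangular_transform A $$ (k, j)) =
        of_real (weight t k i j) * (cnj (A $$ (k, i)) * A $$ (k, j))" if k: "k < m" for k
    proof -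
      have "of_real (weight t k i j) *
            (cnj (triangular_transform A $$ (k, i)) * triangular_transform A $$ (k, j)) =
          of_real (of_int (sgn (int k - int i) * sgn (int k - int j)) * weight t k i j) *
            (cnj (A $$ (k, i)) * A $$ (k, j))"
        by (simp add: triangular_transform_nth[OF A k] ij)
      then show ?thesis by (simp only: sgn_mult_weight)
    qed
    then show "carre_du_champ t (triangular_transform A) $$ (i, j) = carre_du_champ t A $$ (i, j)"
      unfolding carre_du_champ_nth[OF A ij] carre_du_champ_nth[OF TA ij]
      by (intro sum.cong) auto
  qed (use carre_du_champ_carrier[OF A, of t] carre_du_champ_carrier[OF TA, of t] in auto)
qed

theorem mainTheorem1:
  fixes n :: nat and A :: "complex mat"
  assumes "n \<ge> 1" and "A \<in> carrier_mat n n"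
  shows "bmo_c_norm exp_semigroup (triangular_transform A) = bmo_c_norm exp_semigroup A"
  unfolding bmo_c_norm_def carre_du_champ_def [symmetric] carre_du_champ_triangular_transform
  by (rule refl)

end
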